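(* For every integer $r\ge -1$, \[ \sum_{n=0}^\infty \frac{\binom{2n}{n}\binom{2n+2r+2}{n+r+1}}{(n+1)(2n+1)2^{4n+2r+4}}=\frac{1}{\pi}\int_0^{\pi/2}z\sin^{2r+1}z\,dz-\frac{1}{2^{2r+1}}\binom{2r}{r}+\frac{1}{\pi(2r+1)}. \]
   Context: Binomial coefficients follow the convention $\binom{m}{k}=0$ for $k<0$ (so for $r=-1$ the term $\binom{2r}{r}=\binom{-2}{-1}$ equals $0$). *)

theory Defs
  imports "HOL-Analysis.Analysis"
begin

text \<open>
  Binomial coefficient with integer entries: it vanishes for a negative lower entry, and is the
  usual falling-factorial quotient (whatever the sign of the upper entry) otherwise.
\<close>

definition int_binom :: "int \<Rightarrow> int \<Rightarrow> real" where
  "int_binom m k = (if k < 0 then 0 else of_int m gchoose nat k)"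

end

theory Submission
  imports Defs
begin

text \<open>
  Let \<open>w\<^sub>n\<close> be the normalised central binomial coefficient, so that
  \<open>\<integral> sin\<^sup>2\<^sup>m = (\<pi>/2) w\<^sub>m\<close> over \<open>[0, \<pi>/2]\<close> and
  \<open>\<Sum> w\<^sub>n y\<^sup>n = 1 / sqrt (1 - y)\<close>. At \<open>y = sin\<^sup>2 z\<close>, two integrations in \<open>z\<close> give
  \<open>\<Sum> w\<^sub>n sin\<^sup>2\<^sup>n\<^sup>+\<^sup>2 z / ((n+1)(2n+1)) = 2 z sin z - 2 (1 - cos z)\<close>. Multiplying by
  \<open>sin\<^sup>2\<^sup>r z\<close> and integrating termwise (the series converges uniformly on \<open>[0, \<pi>/2]\<close>) yields
  the identity. Writing \<open>(1 - cos z) / sin\<^sup>2 z = 1 / (1 + cos z)\<close> removes the singularity at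
  \<open>0\<close>, so that \<open>r = -1\<close> needs no separate treatment of convergence.
\<close>

section \<open>Normalised central binomial coefficients and their generating function\<close>

definition cbinom :: "nat \<Rightarrow> real" where
  "cbinom n = real (2 * n choose n) / 4 ^ n"

lemma cbinom_0 [simp]: "cbinom 0 = 1"
  by (simp add: cbinom_def)

text \<open>The absorption identity is applied twice, from row 2n+2 to row 2n+1 and on to row 2n;
  symmetry of the odd row joins the two applications.\<close>

lemma cbinom_Suc: "cbinom (Suc n) = cbinom n * (2 * real n + 1) / (2 * real n + 2)"
proof -
  have "real (Suc n * (Suc (2 * n + 1) choose Suc n)) = real (Suc (2 * n + 1) * (2 * n + 1 choose n))"
    by (simp only: Suc_times_binomial)
  then have 1: "(real n + 1) * real (2 * n + 2 choose Suc n)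
      = (2 * real n + 2) * real (2 * n + 1 choose n)"
    by (simp add: algebra_simps del: binomial_Suc_Suc)
  have "real (Suc n * (Suc (2 * n) choose Suc n)) = real (Suc (2 * n) * (2 * n choose n))"
    by (simp only: Suc_times_binomial)
  moreover have "Suc (2 * n) choose Suc n = 2 * n + 1 choose n"
    by (subst binomial_symmetric) auto
  ultimately have 2: "(real n + 1) * real (2 * n + 1 choose n)
      = (2 * real n + 1) * real (2 * n choose n)"
    by (simp only: of_nat_mult of_nat_Suc) (simp add: algebra_simps del: binomial_Suc_Suc)
  have "(real n + 1) * real (2 * n + 2 choose Suc n)
      = (real n + 1) * (2 * real (2 * n + 1 choose n))"
    using 1 by (simp only: distrib_right mult_1_left)
  then have "real (2 * n + 2 choose Suc n) = 2 * real (2 * n + 1 choose n)"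
    by (rule mult_left_cancel[THEN iffD1, rotated]) linarith
  \<comment> \<open>The elimination is done with variables for the binomials, so that simplification
    treats them as atoms.\<close>
  moreover have "x = 4 * (w * (2 * real n + 1) / (2 * real n + 2))"
    if "x = 2 * y" "(real n + 1) * y = (2 * real n + 1) * w" for x y w
    using that by (simp add: field_simps)
  ultimately have "real (2 * n + 2 choose Suc n)
      = 4 * (real (2 * n choose n) * (2 * real n + 1) / (2 * real n + 2))"
    using 2 by blast
  then show ?thesis
    by (simp add: cbinom_def del: binomial_Suc_Suc)
qed

lemma cbinom_bounds: "0 \<le> cbinom n" "cbinom n \<le> 1"
proof -
  show "0 \<le> cbinom n" for n
    by (simp add: cbinom_def)
  then show "cbinom n \<le> 1"
  proof (induction n)
    case (Suc n)
    then have "cbinom n * (2 * real n + 1) \<le> 1 * (2 * real n + 2)"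
      by (intro mult_mono) auto
    then show ?case
      by (simp add: cbinom_Suc)
  qed simp
qed

text \<open>Both sides have successive ratio (2n+1)/(2n+2). This makes the generating function an
  instance of the binomial series with exponent -1/2.\<close>

lemma cbinom_gchoose: "cbinom n = (- 1) ^ n * ((- 1 / 2) gchoose n)"
proof (induction n)
  case (Suc n)
  have "(- 1 / 2) * ((- 1 / 2) gchoose n)
      = real n * ((- 1 / 2) gchoose n) + (real n + 1) * ((- 1 / 2 :: real) gchoose Suc n)"
    using gbinomial_mult_1[of "- 1 / 2 :: real" n] by (simp add: add.commute)
  then have "(- 1 / 2 :: real) gchoose Suc n
      = - ((2 * real n + 1) / (2 * real n + 2)) * ((- 1 / 2) gchoose n)"
    by (simp add: field_simps)
  with Suc show ?case
    by (simp add: cbinom_Suc)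
qed simp

lemma cbinom_sums:
  assumes "\<bar>y\<bar> < 1"
  shows "(\<lambda>n. cbinom n * y ^ n) sums (1 / sqrt (1 - y))"
proof -
  have "(\<lambda>n. ((- 1 / 2) gchoose n) * (- y) ^ n) sums (1 + - y) powr (- 1 / 2)"
    by (rule gen_binomial_real) (use assms in auto)
  moreover have "((- 1 / 2) gchoose n) * (- y) ^ n = cbinom n * y ^ n" for n
    using power_minus[of y n] by (simp add: cbinom_gchoose)
  moreover have "(1 + - y) powr (- 1 / 2) = 1 / sqrt (1 - y)"
    using assms by (simp add: powr_minus_divide powr_half_sqrt)
  ultimately show ?thesis
    by simp
qed

section \<open>Wallis integrals\<close>

lemma sin_power_has_integral:
  "((\<lambda>z. sin z ^ (2 * m)) has_integral pi / 2 * cbinom m) {0..pi / 2}"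
proof (induction m)
  case 0
  show ?case
    using has_integral_const_real[of "1 :: real" 0 "pi / 2"] by simp
next
  case (Suc m)
  \<comment> \<open>This integrand is the derivative of \<open>sin z ^ (2 * m + 1) * cos z\<close>,
    with \<open>cos\<close> squared eliminated. The boundary terms vanish, so the Wallis recursion
    follows, with the same ratio as in \<open>cbinom_Suc\<close>.\<close>
  have "((\<lambda>z. (2 * real m + 1) * sin z ^ (2 * m) - (2 * real m + 2) * sin z ^ (2 * Suc m))
      has_integral (sin (pi / 2) ^ (2 * m + 1) * cos (pi / 2) - sin 0 ^ (2 * m + 1) * cos 0))
      {0..pi / 2}"
  proof (rule fundamental_theorem_of_calculus)
    fix z :: real
    have "((\<lambda>z. sin z ^ (2 * m + 1) * cos z) has_real_derivative
       (2 * real m + 1) * sin z ^ (2 * m) * (cos z)\<^sup>2 - sin z ^ (2 * m + 2)) (at z)"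
      by (rule derivative_eq_intros refl)+ (simp add: algebra_simps power2_eq_square)
    also have "(2 * real m + 1) * sin z ^ (2 * m) * (cos z)\<^sup>2 - sin z ^ (2 * m + 2)
        = (2 * real m + 1) * sin z ^ (2 * m) - (2 * real m + 2) * sin z ^ (2 * Suc m)"
      unfolding cos_squared_eq by (simp add: algebra_simps power2_eq_square)
    finally show "((\<lambda>z. sin z ^ (2 * m + 1) * cos z) has_vector_derivative
       (2 * real m + 1) * sin z ^ (2 * m) - (2 * real m + 2) * sin z ^ (2 * Suc m))
       (at z within {0..pi / 2})"
      by (simp add: has_real_derivative_iff_has_vector_derivative has_vector_derivative_at_within)
  qed simp
  from has_integral_diff[OF has_integral_mult_right[OF Suc, of "2 * real m + 1"] this]
  have "((\<lambda>z. (2 * real m + 2) * sin z ^ (2 * Suc m)) has_integral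
      (2 * real m + 1) * (pi / 2 * cbinom m)) {0..pi / 2}"
    by (simp add: algebra_simps)
  from has_integral_mult_right[OF this, of "1 / (2 * real m + 2)"]
  have "((\<lambda>z. sin z ^ (2 * Suc m)) has_integral
      1 / (2 * real m + 2) * ((2 * real m + 1) * (pi / 2 * cbinom m))) {0..pi / 2}"
    by (simp flip: mult.assoc del: mult_Suc_right power_Suc)
  then show ?case
    by (simp add: cbinom_Suc mult_ac)
qed

section \<open>Power series evaluated at the squared sine\<close>

text \<open>A geometric majorant allows termwise differentiation in the unit disc. The form
  \<open>y * D\<close> keeps the exponents unchanged, so a factor n+1 or 2n+1 is cleared by adding
  series, without dividing by \<open>y\<close>, which is 0 at z = 0.\<close>

lemma powser_euler:
  fixes a :: "nat \<Rightarrow> real"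
  assumes "\<And>n. \<bar>a n\<bar> \<le> 1" and y: "\<bar>y\<bar> < 1"
  obtains D where "((\<lambda>x. \<Sum>n. a n * x ^ n) has_real_derivative D) (at y)"
    and "(\<lambda>n. real n * a n * y ^ n) sums (y * D)"
    and "(\<lambda>n. a n * y ^ n) sums (\<Sum>n. a n * y ^ n)"
proof -
  have sm: "summable (\<lambda>n. a n * x ^ n)" if "norm x < 1" for x :: real
  proof (rule summable_comparison_test')
    show "summable (\<lambda>n. \<bar>x\<bar> ^ n)"
      using that by (simp add: summable_geometric)
    show "norm (a n * x ^ n) \<le> \<bar>x\<bar> ^ n" if "n \<ge> 0" for n
      using mult_right_mono[OF assms(1)[of n], of "\<bar>x\<bar> ^ n"] by (simp add: abs_mult power_abs)
  qed
  define D where "D = (\<Sum>n. diffs a n * y ^ n)"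
  have "((\<lambda>x. \<Sum>n. a n * x ^ n) has_real_derivative D) (at y)"
    unfolding D_def by (rule termdiffs_strong'[OF sm]) (use y in auto)
  moreover have "(\<lambda>n. real n * a n * y ^ n) sums (y * D)"
  proof -
    have "summable (\<lambda>n. diffs a n * y ^ n)"
      by (rule termdiff_converges[OF _ sm]) (use y in auto)
    then have "(\<lambda>n. y * (diffs a n * y ^ n)) sums (y * D)"
      unfolding D_def by (intro sums_mult summable_sums)
    then have "(\<lambda>n. real (Suc n) * a (Suc n) * y ^ Suc n) sums (y * D)"
      by (simp add: diffs_def mult_ac)
    \<comment> \<open>The term of index 0 carries the factor 0, so undoing the shift leaves the sum
      unchanged.\<close>
    then show ?thesis
      by (subst (asm) sums_Suc_iff) simp
  qed
  ultimately show thesis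
    using sm y summable_sums that by auto
qed

lemma sin_squared_less_1:
  assumes "z \<in> {- (pi / 2)<..<pi / 2}"
  shows "\<bar>(sin z)\<^sup>2\<bar> < 1" "0 < cos z"
proof -
  show "0 < cos z"
    using assms by (intro cos_gt_zero_pi) auto
  then have "0 < (cos z)\<^sup>2"
    by simp
  then show "\<bar>(sin z)\<^sup>2\<bar> < 1"
    using sin_squared_eq[of z] zero_le_power2[of "sin z"] by linarith
qed

text \<open>The arcsine series at sin z. The difference of the two sides vanishes at 0 and has
  derivative 0: applying 2y d/dy + 1 to \<open>B\<close> clears the denominator 2n+1 and leaves
  1/sqrt(1-y). The interval is open to keep y < 1, and symmetric to have 0 in its interior.\<close>

lemma arcsin_series:
  assumes z: "z \<in> {- (pi / 2)<..<pi / 2}"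
  shows "sin z * (\<Sum>n. cbinom n / (2 * real n + 1) * (sin z)\<^sup>2 ^ n) = z"
proof -
  define b where "b n = cbinom n / (2 * real n + 1)" for n
  define B where "B = (\<lambda>y::real. \<Sum>n. b n * y ^ n)"
  have b: "\<bar>b n\<bar> \<le> 1" for n
    using cbinom_bounds[of n] by (simp add: b_def field_simps)
  let ?h = "\<lambda>z. sin z * B ((sin z)\<^sup>2) - z"
  have "?h z = ?h 0"
  proof (rule DERIV_isconst3[of "- (pi / 2)" "pi / 2" z 0 ?h])
    fix x assume x: "x \<in> {- (pi / 2)<..<pi / 2}"
    note x1 = sin_squared_less_1[OF x]
    obtain D where D: "(B has_real_derivative D) (at ((sin x)\<^sup>2))"
      "(\<lambda>n. real n * b n * (sin x)\<^sup>2 ^ n) sums ((sin x)\<^sup>2 * D)"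
      "(\<lambda>n. b n * (sin x)\<^sup>2 ^ n) sums B ((sin x)\<^sup>2)"
      unfolding B_def by (rule powser_euler[OF b x1(1)])
    have "(\<lambda>n. 2 * (real n * b n * (sin x)\<^sup>2 ^ n) + b n * (sin x)\<^sup>2 ^ n)
        sums (2 * ((sin x)\<^sup>2 * D) + B ((sin x)\<^sup>2))"
      by (intro sums_add sums_mult D)
    also have "(\<lambda>n. 2 * (real n * b n * (sin x)\<^sup>2 ^ n) + b n * (sin x)\<^sup>2 ^ n)
        = (\<lambda>n. cbinom n * (sin x)\<^sup>2 ^ n)"
    proof
      fix n
      have "cbinom n = (2 * real n + 1) * b n"
        by (simp add: b_def field_simps)
      then show "2 * (real n * b n * (sin x)\<^sup>2 ^ n) + b n * (sin x)\<^sup>2 ^ n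
          = cbinom n * (sin x)\<^sup>2 ^ n"
        by (simp add: algebra_simps)
    qed
    finally have "2 * ((sin x)\<^sup>2 * D) + B ((sin x)\<^sup>2) = 1 / sqrt (1 - (sin x)\<^sup>2)"
      using cbinom_sums[OF x1(1)] sums_unique2 by blast
    \<comment> \<open>Positivity of \<open>cos x\<close> identifies the square root with
      \<open>cos x\<close> itself.\<close>
    then have eq: "cos x * (2 * ((sin x)\<^sup>2 * D) + B ((sin x)\<^sup>2)) = 1"
      using x1(2) by (simp flip: cos_squared_eq)
    have "((\<lambda>z. B ((sin z)\<^sup>2)) has_real_derivative D * (2 * sin x * cos x)) (at x)"
      by (rule DERIV_chain2[where g = "\<lambda>z. (sin z)\<^sup>2", OF D(1)])
        (auto intro!: derivative_eq_intros)
    then have "(?h has_real_derivative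
        (cos x * B ((sin x)\<^sup>2) + D * (2 * sin x * cos x) * sin x) - 1) (at x)"
      by (intro DERIV_diff DERIV_mult DERIV_sin DERIV_ident)
    also have "(cos x * B ((sin x)\<^sup>2) + D * (2 * sin x * cos x) * sin x) - 1 = 0"
      using eq by (simp add: algebra_simps power2_eq_square)
    finally show "(?h has_real_derivative 0) (at x)" .
  qed (use z in auto)
  then show ?thesis
    by (simp add: B_def b_def)
qed

text \<open>The second integration follows the same scheme: y d/dy + 1 clears the denominator n+1
  and leaves the arcsine series, while the right-hand side has derivative 2z cos z because its sine
  terms cancel.\<close>

lemma cbinom_sin_series:
  assumes z: "z \<in> {- (pi / 2)<..<pi / 2}"
  shows "(sin z)\<^sup>2 * (\<Sum>n. cbinom n / ((real n + 1) * (2 * real n + 1)) * (sin z)\<^sup>2 ^ n)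
    = 2 * z * sin z - 2 * (1 - cos z)"
proof -
  define a where "a n = cbinom n / ((real n + 1) * (2 * real n + 1))" for n
  define A where "A = (\<lambda>y::real. \<Sum>n. a n * y ^ n)"
  have a: "\<bar>a n\<bar> \<le> 1" for n
  proof -
    have "cbinom n \<le> 1 * 1"
      using cbinom_bounds[of n] by simp
    also have "\<dots> \<le> (real n + 1) * (2 * real n + 1)"
      by (intro mult_mono) auto
    finally show ?thesis
      using cbinom_bounds[of n] by (simp add: a_def)
  qed
  let ?h = "\<lambda>z. (sin z)\<^sup>2 * A ((sin z)\<^sup>2) - (2 * z * sin z - 2 * (1 - cos z))"
  have "?h z = ?h 0"
  proof (rule DERIV_isconst3[of "- (pi / 2)" "pi / 2" z 0 ?h])
    fix x assume x: "x \<in> {- (pi / 2)<..<pi / 2}"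
    note x1 = sin_squared_less_1[OF x]
    obtain D where D: "(A has_real_derivative D) (at ((sin x)\<^sup>2))"
      "(\<lambda>n. real n * a n * (sin x)\<^sup>2 ^ n) sums ((sin x)\<^sup>2 * D)"
      "(\<lambda>n. a n * (sin x)\<^sup>2 ^ n) sums A ((sin x)\<^sup>2)"
      unfolding A_def by (rule powser_euler[OF a x1(1)])
    have "(\<lambda>n. real n * a n * (sin x)\<^sup>2 ^ n + a n * (sin x)\<^sup>2 ^ n)
        sums ((sin x)\<^sup>2 * D + A ((sin x)\<^sup>2))"
      by (intro sums_add D)
    also have "(\<lambda>n. real n * a n * (sin x)\<^sup>2 ^ n + a n * (sin x)\<^sup>2 ^ n)
        = (\<lambda>n. cbinom n / (2 * real n + 1) * (sin x)\<^sup>2 ^ n)"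
    proof
      fix n
      have "cbinom n / (2 * real n + 1) = (real n + 1) * a n"
        by (simp add: a_def)
      then show "real n * a n * (sin x)\<^sup>2 ^ n + a n * (sin x)\<^sup>2 ^ n
          = cbinom n / (2 * real n + 1) * (sin x)\<^sup>2 ^ n"
        by (simp only:) (simp add: algebra_simps)
    qed
    finally have eq: "sin x * ((sin x)\<^sup>2 * D + A ((sin x)\<^sup>2)) = x"
      using arcsin_series[OF x] by (simp add: sums_iff)
    have "((\<lambda>z. A ((sin z)\<^sup>2)) has_real_derivative D * (2 * sin x * cos x)) (at x)"
      by (rule DERIV_chain2[where g = "\<lambda>z. (sin z)\<^sup>2", OF D(1)])
        (auto intro!: derivative_eq_intros)
    moreover have "((\<lambda>z. (sin z)\<^sup>2) has_real_derivative 2 * sin x * cos x) (at x)"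
      by (auto intro!: derivative_eq_intros)
    moreover have "((\<lambda>z. 2 * z * sin z - 2 * (1 - cos z)) has_real_derivative 2 * x * cos x) (at x)"
      by (auto intro!: derivative_eq_intros)
    ultimately have "(?h has_real_derivative (2 * sin x * cos x * A ((sin x)\<^sup>2)
          + D * (2 * sin x * cos x) * (sin x)\<^sup>2) - 2 * x * cos x) (at x)"
      by (intro DERIV_diff DERIV_mult)
    also have "(2 * sin x * cos x * A ((sin x)\<^sup>2) + D * (2 * sin x * cos x) * (sin x)\<^sup>2)
        - 2 * x * cos x = 2 * cos x * (sin x * ((sin x)\<^sup>2 * D + A ((sin x)\<^sup>2)) - x)"
      by (simp add: algebra_simps)
    finally show "(?h has_real_derivative 0) (at x)"
      by (simp add: eq)
  qed (use z in auto)
  then show ?thesis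
    by (simp add: A_def a_def)
qed

section \<open>Termwise integration against an even power of the sine\<close>

text \<open>For k = 0 the antiderivative is tan(z/2). Otherwise one factor sin^2 z = (1 - cos z)(1 +
  cos z) cancels the denominator, leaving a Wallis integral minus the integral of an exact
  derivative. The case split stops \<open>k - 1\<close> from truncating to 0 and contributing a
  spurious pi/2.\<close>

lemma sin_power_over_one_plus_cos_has_integral:
  "((\<lambda>z. sin z ^ (2 * k) / (1 + cos z)) has_integral
    (if k = 0 then 1 else pi / 2 * cbinom (k - 1) - 1 / (2 * real k - 1))) {0..pi / 2}"
proof (cases k)
  case 0
  have "((\<lambda>z. 1 / (1 + cos z)) has_integral (tan (pi / 2 / 2) - tan (0 / 2))) {0..pi / 2}"
  proof (rule fundamental_theorem_of_calculus)
    fix z :: real assume "z \<in> {0..pi / 2}"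
    then have c: "0 < cos (z / 2)"
      using pi_gt_zero by (intro cos_gt_zero_pi) (auto simp: field_simps simp del: pi_gt_zero)
    have "((\<lambda>z. tan (z / 2)) has_real_derivative inverse ((cos (z / 2))\<^sup>2) * (1 / 2)) (at z)"
      by (rule DERIV_chain2[where g = "\<lambda>z. z / 2", OF DERIV_tan])
        (use c in \<open>auto intro!: derivative_eq_intros\<close>)
    also have "inverse ((cos (z / 2))\<^sup>2) * (1 / 2) = 1 / (1 + cos z)"
      using cos_double_cos[of "z / 2"] by (simp add: field_simps)
    finally show "((\<lambda>z. tan (z / 2)) has_vector_derivative 1 / (1 + cos z))
        (at z within {0..pi / 2})"
      by (simp add: has_real_derivative_iff_has_vector_derivative has_vector_derivative_at_within)
  qed simp
  with 0 show ?thesis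
    by (simp add: tan_45)
next
  case (Suc m)
  have "((\<lambda>z. sin z ^ (2 * m) * cos z) has_integral
      (sin (pi / 2) ^ (2 * m + 1) / (2 * real m + 1) - sin 0 ^ (2 * m + 1) / (2 * real m + 1)))
      {0..pi / 2}"
  proof (rule fundamental_theorem_of_calculus)
    fix z :: real
    have "((\<lambda>z. sin z ^ (2 * m + 1)) has_real_derivative
        (2 * real m + 1) * (sin z ^ (2 * m) * cos z)) (at z)"
      by (rule derivative_eq_intros refl)+ simp
    from DERIV_cdivide[OF this, of "2 * real m + 1"]
    show "((\<lambda>z. sin z ^ (2 * m + 1) / (2 * real m + 1)) has_vector_derivative
        sin z ^ (2 * m) * cos z) (at z within {0..pi / 2})"
      by (simp add: has_real_derivative_iff_has_vector_derivative has_vector_derivative_at_within)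
  qed simp
  from has_integral_diff[OF sin_power_has_integral[of m] this]
  have "((\<lambda>z. sin z ^ (2 * m) - sin z ^ (2 * m) * cos z) has_integral
      (if k = 0 then 1 else pi / 2 * cbinom (k - 1) - 1 / (2 * real k - 1))) {0..pi / 2}"
    by (simp add: Suc algebra_simps)
  moreover have "sin z ^ (2 * k) / (1 + cos z) = sin z ^ (2 * m) - sin z ^ (2 * m) * cos z"
    if "z \<in> {0..pi / 2}" for z
  proof -
    have "0 \<le> cos z"
      using that by (intro cos_ge_zero) auto
    then have nz: "1 + cos z \<noteq> 0"
      by linarith
    have "(sin z)\<^sup>2 = (1 - cos z) * (1 + cos z)"
      unfolding sin_squared_eq by (simp add: algebra_simps power2_eq_square)
    moreover have "sin z ^ (2 * k) = sin z ^ (2 * m) * (sin z)\<^sup>2"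
      by (simp add: Suc power2_eq_square)
    ultimately have "sin z ^ (2 * k) = (sin z ^ (2 * m) - sin z ^ (2 * m) * cos z) * (1 + cos z)"
      by (simp only:) (simp add: algebra_simps)
    with nz show ?thesis
      by (simp only: nonzero_divide_eq_eq not_False_eq_True)
  qed
  ultimately show ?thesis
    using has_integral_cong by (metis (no_types, lifting))
qed

text \<open>Here k stands for r + 1, and \<open>J\<close> is the integral of the series multiplied
  by sin^(2k) z. It is left unevaluated because it only links the sum to the integral.\<close>

lemma cbinom_product_sums:
  obtains J where
    "(\<lambda>n. cbinom n * cbinom (n + k) / ((real n + 1) * (2 * real n + 1))) sums (2 * J / pi)"
    and "((\<lambda>z. z * sin z powi (2 * int k - 1)) has_integral
      (J / 2 + (if k = 0 then 1 else pi / 2 * cbinom (k - 1) - 1 / (2 * real k - 1)))) {0..pi / 2}"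
proof -
  define a where "a n = cbinom n / ((real n + 1) * (2 * real n + 1))" for n
  define f where "f n z = a n * sin z ^ (2 * (n + k))" for n z
  define g where "g z = (\<Sum>n. f n z)" for z
  \<comment> \<open>A summable majorant is needed that also covers z = pi/2, where the powers of the
    sine do not decay.\<close>
  have a: "\<bar>a n\<bar> \<le> inverse (real (Suc n) ^ 2)" for n
  proof -
    have "cbinom n / ((real n + 1) * (2 * real n + 1)) \<le> 1 / ((real n + 1) * (real n + 1))"
      using cbinom_bounds[of n] by (intro frac_le mult_left_mono) auto
    then show ?thesis
      using cbinom_bounds[of n] by (simp add: a_def field_simps power2_eq_square)
  qed
  have unif: "uniform_limit {0..pi / 2} (\<lambda>N z. \<Sum>n<N. f n z) g sequentially"
    unfolding g_def
  proof (rule Weierstrass_m_test)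
    show "norm (f n z) \<le> inverse (real (Suc n) ^ 2)" for n z
    proof -
      have "\<bar>sin z ^ (2 * (n + k))\<bar> \<le> 1"
        by (simp add: power_abs power_le_one)
      then have "\<bar>a n\<bar> * \<bar>sin z ^ (2 * (n + k))\<bar> \<le> \<bar>a n\<bar> * 1"
        by (rule mult_left_mono) simp
      with a[of n] show ?thesis
        by (simp add: f_def abs_mult)
    qed
    show "summable (\<lambda>n. inverse (real (Suc n) ^ 2))"
      using inverse_power_summable[of 2, where 'a = real] by (subst summable_Suc_iff) simp
  qed
  have cont: "continuous_on {0..pi / 2} (\<lambda>z. \<Sum>n<N. f n z)" for N
    unfolding f_def by (intro continuous_intros)
  obtain I J where I: "\<And>N. ((\<lambda>z. \<Sum>n<N. f n z) has_integral I N) {0..pi / 2}"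
    and J: "(g has_integral J) {0..pi / 2}" and lim: "I \<longlonglongrightarrow> J"
    using uniform_limit_integral[OF unif cont] by auto
  have "((\<lambda>z. \<Sum>n<N. f n z) has_integral (\<Sum>n<N. a n * (pi / 2 * cbinom (n + k)))) {0..pi / 2}" for N
    unfolding f_def
    by (intro has_integral_sum has_integral_mult_right sin_power_has_integral) auto
  with I have "I = (\<lambda>N. \<Sum>n<N. a n * (pi / 2 * cbinom (n + k)))"
    using has_integral_unique by blast
  with lim have "(\<lambda>n. a n * (pi / 2 * cbinom (n + k))) sums J"
    by (simp add: sums_def)
  from sums_mult[OF this, of "2 / pi"]
  have 1: "(\<lambda>n. cbinom n * cbinom (n + k) / ((real n + 1) * (2 * real n + 1))) sums (2 * J / pi)"
    by (simp add: a_def mult_ac)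
  have "((\<lambda>z. g z / 2 + sin z ^ (2 * k) / (1 + cos z)) has_integral
      (J / 2 + (if k = 0 then 1 else pi / 2 * cbinom (k - 1) - 1 / (2 * real k - 1)))) {0..pi / 2}"
    by (intro has_integral_add has_integral_divide J sin_power_over_one_plus_cos_has_integral)
  then have 2: "((\<lambda>z. z * sin z powi (2 * int k - 1)) has_integral
      (J / 2 + (if k = 0 then 1 else pi / 2 * cbinom (k - 1) - 1 / (2 * real k - 1)))) {0..pi / 2}"
  proof (rule has_integral_spike_finite[rotated 2])
    fix z assume "z \<in> {0..pi / 2} - {0, pi / 2}"
    then have z: "0 < z" "z < pi / 2"
      by auto
    then have s: "0 < sin z" and c: "0 < cos z"
      by (auto intro!: sin_gt_zero cos_gt_zero)
    have z1: "\<bar>(sin z)\<^sup>2\<bar> < 1"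
      by (rule sin_squared_less_1) (use z in auto)
    have "\<bar>a n\<bar> \<le> 1" for n
      by (rule order_trans[OF a]) (simp add: field_simps)
    then have "summable (\<lambda>n. a n * (sin z)\<^sup>2 ^ n)"
      by (rule powser_euler[OF _ z1]) (rule sums_summable)
    then have "g z = (sin z) ^ (2 * k) * (\<Sum>n. a n * (sin z)\<^sup>2 ^ n)"
      unfolding g_def f_def
      by (simp add: power_mult power_add mult_ac power_mult_distrib flip: suminf_mult power_mult)
    then have "g z * (sin z)\<^sup>2 = sin z ^ (2 * k) * (2 * z * sin z - 2 * (1 - cos z))"
      using cbinom_sin_series[of z] z unfolding a_def by (simp add: mult_ac)
    moreover have "1 - cos z = (sin z)\<^sup>2 / (1 + cos z)"
      using c by (simp add: sin_squared_eq field_simps power2_eq_square)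
    then have "2 * z * sin z - 2 * (1 - cos z) = (2 * z / sin z - 2 / (1 + cos z)) * (sin z)\<^sup>2"
      using s by (simp add: left_diff_distrib power2_eq_square)
    ultimately have "g z * (sin z)\<^sup>2
        = sin z ^ (2 * k) * (2 * z / sin z - 2 / (1 + cos z)) * (sin z)\<^sup>2"
      by (simp only: mult.assoc)
    then have "g z = sin z ^ (2 * k) * (2 * z / sin z - 2 / (1 + cos z))"
      using s by simp
    then have "g z = 2 * (z * (sin z ^ (2 * k) / sin z)) - 2 * (sin z ^ (2 * k) / (1 + cos z))"
      by (simp add: right_diff_distrib mult_ac)
    moreover have "z * sin z powi (2 * int k - 1) = z * (sin z ^ (2 * k) / sin z)"
      using s by (simp add: power_int_diff flip: power_int_of_nat)
    ultimately show "z * sin z powi (2 * int k - 1) = g z / 2 + sin z ^ (2 * k) / (1 + cos z)"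
      by linarith
  qed simp
  show thesis
    using that 1 2 by blast
qed

section \<open>Return to integer binomial coefficients\<close>

lemma int_binom_central: "int_binom (2 * int n) (int n) = 4 ^ n * cbinom n"
proof -
  have "int_binom (2 * int n) (int n) = real (2 * n) gchoose n"
    by (simp add: int_binom_def)
  then show ?thesis
    by (simp only: cbinom_def flip: binomial_gbinomial) simp
qed

theorem theorem14:
  fixes r :: int
  assumes "r \<ge> - 1"
  shows "(\<lambda>z::real. z * sin z powi (2 * r + 1)) integrable_on {0..pi / 2} \<and>
    (\<lambda>n::nat. int_binom (2 * int n) (int n) * int_binom (2 * int n + 2 * r + 2) (int n + r + 1)
        / ((real n + 1) * (2 * real n + 1) * 2 powi (4 * int n + 2 * r + 4)))
      sums
      (1 / pi * integral {0..pi / 2} (\<lambda>z::real. z * sin z powi (2 * r + 1))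
        - 1 / 2 powi (2 * r + 1) * int_binom (2 * r) r
        + 1 / (pi * (2 * real_of_int r + 1)))"
proof -
  define k where "k = nat (r + 1)"
  have r: "r = int k - 1"
    using assms by (simp add: k_def)
  \<comment> \<open>\<open>V\<close> is the part of the integral that the two closed terms of the
    claim must cancel.\<close>
  define V where "V = (if k = 0 then 1 else pi / 2 * cbinom (k - 1) - 1 / (2 * real k - 1))"
  obtain J where
    J: "(\<lambda>n. cbinom n * cbinom (n + k) / ((real n + 1) * (2 * real n + 1))) sums (2 * J / pi)"
    and int: "((\<lambda>z. z * sin z powi (2 * int k - 1)) has_integral (J / 2 + V)) {0..pi / 2}"
    unfolding V_def by (rule cbinom_product_sums)
  have exponent: "2 * r + 1 = 2 * int k - 1"
    by (simp add: r)
  \<comment> \<open>For k = 0 the binomial is 0 by its negative lower entry, and the last term -1/pi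
    cancels \<open>V / pi\<close>. For k = m + 1 the terms cancel in pairs.\<close>
  have V: "V / pi - 1 / 2 powi (2 * r + 1) * int_binom (2 * r) r
      + 1 / (pi * (2 * real_of_int r + 1)) = 0"
  proof (cases k)
    case 0
    then show ?thesis
      by (simp add: r V_def int_binom_def)
  next
    case (Suc m)
    have "(2::real) powi (2 * int m + 1) = 2 * 4 ^ m"
      by (simp add: power_int_add power_int_mult)
    moreover have "V / pi = cbinom m / 2 - 1 / (pi * (2 * real m + 1))"
      by (simp add: V_def Suc diff_divide_distrib)
    ultimately show ?thesis
      using int_binom_central[of m] by (simp add: r Suc)
  qed
  \<comment> \<open>The two binomials contribute 4^n and 4^(n+k), against 2^(4n+2k+2) in the
    denominator; the quotient is the factor 1/4.\<close>
  have "int_binom (2 * int n) (int n) * int_binom (2 * int n + 2 * r + 2) (int n + r + 1)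
        / ((real n + 1) * (2 * real n + 1) * 2 powi (4 * int n + 2 * r + 4))
      = 1 / 4 * (cbinom n * cbinom (n + k) / ((real n + 1) * (2 * real n + 1)))" for n
  proof -
    have "int_binom (2 * int n + 2 * r + 2) (int n + r + 1) = 4 ^ (n + k) * cbinom (n + k)"
      using int_binom_central[of "n + k"] by (simp add: r algebra_simps)
    moreover have "(2::real) powi (4 * int n + 2 * r + 4) = 4 * (4 ^ n * 4 ^ (n + k))"
    proof -
      have "4 * int n + 2 * r + 4 = int (2 * (n + (n + k) + 1))"
        by (simp add: r)
      then have "(2::real) powi (4 * int n + 2 * r + 4) = 2 ^ (2 * (n + (n + k) + 1))"
        by (simp only: power_int_of_nat)
      then show ?thesis
        by (simp add: power_mult power_add flip: power_mult_distrib)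
    qed
    ultimately show ?thesis
      by (simp add: int_binom_central)
  qed
  moreover have "1 / 4 * (2 * J / pi)
      = 1 / pi * (J / 2 + V) - 1 / 2 powi (2 * r + 1) * int_binom (2 * r) r
        + 1 / (pi * (2 * real_of_int r + 1))"
  proof -
    have "1 / pi * (J / 2 + V) = 1 / 4 * (2 * J / pi) + V / pi"
      by (simp add: field_simps)
    with V show ?thesis
      by linarith
  qed
  ultimately show ?thesis
    using sums_mult[OF J, of "1 / 4"] int
    by (simp only: exponent integral_unique[OF int] has_integral_integrable)
qed

end
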